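(* Let $n\in\mathbb N$ with $n=2^k$ for some $k\in\mathbb N$, $k\ge 1$. Then the set $$\alpha_n=\left\{S_\sigma\left(\tfrac12\right):\sigma\in\{1,2\}^k\right\}$$ forms a unique optimal CVT with $n$-means for $P$ (that is, $\alpha_n$ forms a CVT with $n$-means, and it is the unique optimal set of $n$-means for $P$), with distortion error $V_n=\left(\frac49\right)^{2k}V$.
   Context: Let $S_1(x)=\frac49x$ and $S_2(x)=\frac49x+\frac59$ on $\mathbb R$, and let $P$ be the unique Borel probability measure on $\mathbb R$ with $P=\frac12P\circ S_1^{-1}+\frac12P\circ S_2^{-1}$; its support is the Cantor set $C$ generated by $S_1,S_2$. For a word $\sigma=\sigma_1\cdots\sigma_k\in\{1,2\}^k$ put $S_\sigma=S_{\sigma_1}\circ\cdots\circ S_{\sigma_k}$. $V$ is the variance of a random variable with distribution $P$. For a finite set $\alpha\subset\mathbb R$, the distortion error is $V(P;\alpha)=\int\min_{a\in\alpha}(x-a)^2\,dP(x)$, and $V_n=\inf\{V(P;\alpha):\alpha\subset\mathbb R,\ \mathrm{card}(\alpha)\le n\}$. A set $\alpha$ with $\mathrm{card}(\alpha)\le n$ attaining the infimum is an optimal set of $n$-means. The Voronoi region of $a\in\alpha$ is $M(a|\alpha)=\{x\in\mathbb R:|x-a|=\min_{b\in\alpha}|x-b|\}$. A set $\alpha$ of $n$ points forms a centroidal Voronoi tessellation (CVT) with $n$-means (for $P$) if for every $a\in\alpha$ we have $P(M(a|\alpha))>0$ and $a=\frac{1}{P(M(a|\alpha))}\int_{M(a|\alpha)}x\,dP(x)$.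 A CVT with $n$-means is optimal if its $n$ generators form an optimal set of $n$-means. *)

theory Defs
  imports "HOL-Probability.Probability"
begin

definition S1 :: "real \<Rightarrow> real" where
  "S1 x = 4/9 * x"

definition S2 :: "real \<Rightarrow> real" where
  "S2 x = 4/9 * x + 5/9"

definition words :: "nat \<Rightarrow> nat list set" where
  "words k = {\<sigma>. length \<sigma> = k \<and> set \<sigma> \<subseteq> {1, 2}}"

text \<open>Only meant for words over \<open>{1, 2}\<close>; every letter other than 1 acts as \<^const>\<open>S2\<close>.\<close>

fun S_word :: "nat list \<Rightarrow> real \<Rightarrow> real" where
  "S_word [] = id"
| "S_word (i # \<sigma>) = (if i = 1 then S1 else S2) \<circ> S_word \<sigma>"

text \<open>The condition that characterises the self-similar measure; by Hutchinson's theorem exactly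
  one measure satisfies it.\<close>

definition is_cantor_measure :: "real measure \<Rightarrow> bool" where
  "is_cantor_measure P \<longleftrightarrow> prob_space P \<and> sets P = sets borel \<and>
    (\<forall>A\<in>sets borel.
      measure P A = 1/2 * measure P (S1 -` A) + 1/2 * measure P (S2 -` A))"

text \<open>The Bochner integral is 0 for non-integrable functions. This case does not arise for the
  measure above, which has compact support. Likewise \<open>Min\<close> is only meaningful for nonempty finite
  sets, so the empty set is excluded as a competitor below.\<close>

definition distortion :: "real measure \<Rightarrow> real set \<Rightarrow> real" where
  "distortion P \<alpha> = (\<integral>x. Min ((\<lambda>a. (x - a)\<^sup>2) ` \<alpha>) \<partial>P)"

definition V_n :: "real measure \<Rightarrow> nat \<Rightarrow> real" where
  "V_n P n = Inf {distortion P \<alpha> | \<alpha>. finite \<alpha> \<and> \<alpha> \<noteq> {} \<and> card \<alpha> \<le> n}"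

definition is_optimal_set :: "real measure \<Rightarrow> nat \<Rightarrow> real set \<Rightarrow> bool" where
  "is_optimal_set P n \<alpha> \<longleftrightarrow>
    finite \<alpha> \<and> \<alpha> \<noteq> {} \<and> card \<alpha> \<le> n \<and> distortion P \<alpha> = V_n P n"

definition voronoi :: "real \<Rightarrow> real set \<Rightarrow> real set" where
  "voronoi a \<alpha> = {x. \<bar>x - a\<bar> = Min ((\<lambda>b. \<bar>x - b\<bar>) ` \<alpha>)}"

definition is_CVT :: "real measure \<Rightarrow> nat \<Rightarrow> real set \<Rightarrow> bool" where
  "is_CVT P n \<alpha> \<longleftrightarrow> finite \<alpha> \<and> card \<alpha> = n \<and>
    (\<forall>a\<in>\<alpha>. measure P (voronoi a \<alpha>) > 0 \<and>
      a = 1 / measure P (voronoi a \<alpha>) * (LINT x:voronoi a \<alpha>|P. x))"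

definition is_optimal_CVT :: "real measure \<Rightarrow> nat \<Rightarrow> real set \<Rightarrow> bool" where
  "is_optimal_CVT P n \<alpha> \<longleftrightarrow> is_CVT P n \<alpha> \<and> is_optimal_set P n \<alpha>"

end

theory Submission
  imports Defs
begin

text \<open>The lower bound on the distortion is a duality argument. Fix a radius \<open>\<rho>\<close>. For every \<open>x\<close>,
\<open>min\<^bsub>a\<in>\<alpha>\<^esub> (x - a)\<^sup>2 \<ge> \<rho>\<^sup>2 - (\<Sum>a\<in>\<alpha>. max 0 (\<rho>\<^sup>2 - (x - a)\<^sup>2))\<close>,
because the summand of a nearest point alone closes the gap. Integrating, the distortion of \<open>\<alpha>\<close> is at
least \<open>\<rho>\<^sup>2\<close> minus the sum over \<open>a \<in> \<alpha>\<close> of \<open>overlap \<rho> a = \<integral> max 0 (\<rho>\<^sup>2 - (x - a)\<^sup>2) dP\<close>. This separates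
the points: it is enough to know how much a single point can save.

Take \<open>\<rho>\<^sub>k = (4/9)\<^sup>k * 9/16\<close>. The central fact, proved in \<open>overlap_grid\<close>, is that
\<open>overlap \<rho>\<^sub>k t \<le> (8/81)\<^sup>k * (81/256 - V)\<close> with equality only if \<open>t\<close> is the midpoint of one of the \<open>2\<^sup>k\<close>
cylinders of level \<open>k\<close>; here \<open>V = 5/52\<close> is the variance. Then \<open>n \<le> 2\<^sup>k\<close> points have distortion at least
\<open>\<rho>\<^sub>k\<^sup>2 - 2\<^sup>k * (8/81)\<^sup>k * (81/256 - V) = (16/81)\<^sup>k * V\<close>, which is what the set of all midpoints attains,
and equality forces the \<open>n\<close> points to be exactly these midpoints. That gives optimality, uniqueness
and, as a by-product, that the midpoints are pairwise distinct.

The central fact goes by induction on \<open>k\<close>: self-similarity expresses the overlap at level \<open>k + 1\<close> as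
\<open>8/81\<close> times the sum of two overlaps at level \<open>k\<close> whose centres are \<open>5/4\<close> apart, so that one has to
see that two cylinders never profit jointly from one point. The choice \<open>\<rho>\<^sub>0 = 9/16\<close> is a compromise.
It exceeds \<open>1/2\<close>, so a window around a midpoint covers the cylinder with some room and the overlap is
an exact parabola there. On the other hand the two copies of the Cantor set in the recursion are
\<open>1/4\<close> apart and \<open>\<rho>\<^sub>1 = 1/4\<close>, so for \<open>k \<ge> 1\<close> a window centred in one copy does not reach the other.
Only the lowest level needs numbers: \<open>cap_sum\<close> bounds the overlap by a piecewise quadratic function,
and \<open>cap_sum_core\<close> compares the sum of two copies of it with \<open>81/256 - V\<close>.

The centroid property follows from optimality: moving one point changes the distortion by
at most a quadratic function of the displacement whose linear coefficient is proportional to the first moment of the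
Voronoi region about the point, so this moment must vanish. The region has positive mass since
otherwise the point could be dropped, contradicting uniqueness.\<close>

section \<open>The self-similar measure and its moments\<close>

locale cantor_measure =
  fixes P :: "real measure"
  assumes cantor: "is_cantor_measure P"
begin

sublocale prob_space P
  using cantor unfolding is_cantor_measure_def by blast

lemma sets_P [measurable_cong, simp]: "sets P = sets borel"
  using cantor unfolding is_cantor_measure_def by blast

lemma prob_UNIV [simp]: "prob UNIV = 1"
  using prob_space sets_eq_imp_space_eq[OF sets_P] by simp

lemma space_P [simp]: "space P = UNIV"
  using sets_eq_imp_space_eq[OF sets_P] by simp

lemma S_measurable [measurable]: "S1 \<in> borel_measurable borel" "S2 \<in> borel_measurable borel"
  unfolding S1_def[abs_def] S2_def[abs_def] by measurable

lemma vimage_S_sets: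
  assumes "A \<in> sets borel"
  shows "S1 -` A \<in> sets borel" "S2 -` A \<in> sets borel"
  using measurable_sets[OF S_measurable(1) assms] measurable_sets[OF S_measurable(2) assms] by auto

lemma measure_self_similar:
  "A \<in> sets borel \<Longrightarrow> prob A = 1/2 * prob (S1 -` A) + 1/2 * prob (S2 -` A)"
  using cantor unfolding is_cantor_measure_def by blast

lemma emeasure_self_similar:
  assumes "A \<in> sets borel"
  shows "2 * emeasure P A = emeasure P (S1 -` A) + emeasure P (S2 -` A)"
proof -
  have "2 * emeasure P A = ennreal (2 * prob A)"
    by (simp add: emeasure_eq_measure ennreal_mult)
  also have "2 * prob A = prob (S1 -` A) + prob (S2 -` A)"
    using measure_self_similar[OF assms] by simp
  finally show ?thesis
    by (simp add: emeasure_eq_measure)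
qed

text \<open>The factor 2 stands on the left so that no division in \<^typ>\<open>ennreal\<close> is needed.\<close>

lemma nn_integral_self_similar:
  fixes f :: "real \<Rightarrow> ennreal"
  assumes "f \<in> borel_measurable borel"
  shows "2 * (\<integral>\<^sup>+x. f x \<partial>P) = (\<integral>\<^sup>+x. f (S1 x) \<partial>P) + (\<integral>\<^sup>+x. f (S2 x) \<partial>P)"
  using assms
proof (induction rule: borel_measurable_induct)
  case (cong f g)
  then show ?case by (metis UNIV_I ext space_borel)
next
  case (set A)
  note [measurable] = set vimage_S_sets[OF set]
  have "indicator A (S1 x) = (indicator (S1 -` A) x :: ennreal)"
    and "indicator A (S2 x) = (indicator (S2 -` A) x :: ennreal)" for x
    by (auto simp: indicator_def)
  then show ?case
    using emeasure_self_similar[OF set] set vimage_S_sets[OF set] by simp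
next
  case (mult u c)
  note [measurable] = mult(2)
  show ?case
    using mult.IH by (simp add: nn_integral_cmult mult.left_commute flip: distrib_left)
next
  case (add u v)
  note [measurable] = add(1,3)
  show ?case
    using add.IH by (simp add: nn_integral_add distrib_left ac_simps)
next
  case (seq U)
  note [measurable] = seq(1)
  have mono: "incseq (\<lambda>i x. U i (T x))" for T :: "real \<Rightarrow> real"
    using seq(3) by (auto simp: incseq_def le_fun_def)
  have lim: "(\<integral>\<^sup>+x. (SUP i. U i) (T x) \<partial>P) = (SUP i. \<integral>\<^sup>+x. U i (T x) \<partial>P)"
    if [measurable]: "T \<in> borel_measurable borel" for T
    using nn_integral_monotone_convergence_SUP[OF mono[of T], of P] by (simp add: image_image)
  have inc: "incseq (\<lambda>i. \<integral>\<^sup>+x. U i (T x) \<partial>P)" for T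
    using seq(3) by (auto simp: incseq_def le_fun_def intro!: nn_integral_mono)
  have "2 * (\<integral>\<^sup>+x. (SUP i. U i) x \<partial>P) = (SUP i. 2 * (\<integral>\<^sup>+x. U i x \<partial>P))"
    using lim[of "\<lambda>x. x"] by (simp add: SUP_mult_left_ennreal)
  also have "\<dots> = (SUP i. (\<integral>\<^sup>+x. U i (S1 x) \<partial>P) + (\<integral>\<^sup>+x. U i (S2 x) \<partial>P))"
    using seq.IH by simp
  also have "\<dots> = (SUP i. \<integral>\<^sup>+x. U i (S1 x) \<partial>P) + (SUP i. \<integral>\<^sup>+x. U i (S2 x) \<partial>P)"
    by (rule ennreal_SUP_add[OF inc inc])
  finally show ?case
    by (simp only: lim[OF S_measurable(1)] lim[OF S_measurable(2)])
qed

text \<open>Both maps expand distances to \<open>[0, 1]\<close> by \<open>9/4\<close> when inverted. If \<open>B y\<close> consists of the points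
beyond distance \<open>y\<close> on one side, its mass is therefore at most that of \<open>B (9/4 * y)\<close>, and iterating
pushes it to infinity.\<close>

lemma tail_zero:
  fixes B :: "real \<Rightarrow> real set"
  assumes sets: "\<And>y. B y \<in> sets borel"
    and step: "\<And>y. y > 0 \<Longrightarrow> S1 -` B y \<subseteq> B (9/4 * y) \<and> S2 -` B y \<subseteq> B (9/4 * y)"
    and anti: "\<And>y z. y \<le> z \<Longrightarrow> B z \<subseteq> B y"
    and empty: "(\<Inter>n. B (real n)) = {}"
    and "y > 0"
  shows "prob (B y) = 0"
proof -
  have one: "prob (B y) \<le> prob (B (9/4 * y))" if "y > 0" for y
    using measure_self_similar[OF sets[of y]]
      finite_measure_mono[of "S1 -` B y" "B (9/4 * y)"]
      finite_measure_mono[of "S2 -` B y" "B (9/4 * y)"] step[OF that] sets by auto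
  have iter: "prob (B y) \<le> prob (B ((9/4)^n * y))" for n
  proof (induction n)
    case (Suc n)
    then show ?case using one[of "(9/4)^n * y"] \<open>y > 0\<close> by (simp add: mult.assoc)
  qed simp
  have "(\<lambda>n. prob (B (real n))) \<longlonglongrightarrow> prob (\<Inter>n. B (real n))"
    by (intro finite_Lim_measure_decseq) (auto simp: sets decseq_def intro!: anti dest: subsetD[OF anti])
  then have lim: "(\<lambda>n. prob (B (real n))) \<longlonglongrightarrow> 0"
    by (simp add: empty)
  have "prob (B y) \<le> prob (B (real m))" for m
  proof -
    obtain n where "real m / y < (9/4)^n"
      using real_arch_pow[of "9/4" "real m / y"] by auto
    then have "real m \<le> (9/4)^n * y"
      using \<open>y > 0\<close> by (simp add: divide_less_eq)
    then show ?thesis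
      using iter[of n] finite_measure_mono[OF anti, of "real m" "(9/4)^n * y"] sets by fastforce
  qed
  then have "prob (B y) \<le> 0"
    by (intro LIMSEQ_le_const[OF lim]) auto
  then show ?thesis
    using measure_nonneg[of P "B y"] by linarith
qed

lemma AE_unit_interval: "AE x in P. 0 \<le> x \<and> x \<le> 1"
proof -
  have r: "prob {1 + y<..} = 0" if "y > 0" for y
  proof (rule tail_zero[of "\<lambda>y. {1 + y<..}", OF _ _ _ _ that])
    show "(\<Inter>n. {1 + real n<..}) = {}"
    proof (safe, goal_cases)
      case (1 x)
      obtain n where "x < real n" using reals_Archimedean2 by blast
      moreover have "1 + real n < x" using 1 by auto
      ultimately show ?case by simp
    qed
  qed (auto simp: S1_def S2_def)
  have l: "prob {..<-y} = 0" if "y > 0" for y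
  proof (rule tail_zero[of "\<lambda>y. {..<-y}", OF _ _ _ _ that])
    show "(\<Inter>n. {..<- real n}) = {}"
    proof (safe, goal_cases)
      case (1 x)
      obtain n where "-x < real n" using reals_Archimedean2 by blast
      moreover have "x < - real n" using 1 by auto
      ultimately show ?case by simp
    qed
  qed (auto simp: S1_def S2_def)
  have "AE x in P. \<forall>n. x \<notin> {1 + inverse (real (Suc n))<..} \<and> x \<notin> {..<- inverse (real (Suc n))}"
    unfolding AE_all_countable
  proof
    fix n
    have p: "0 < inverse (real (Suc n))" by simp
    have "AE x in P. x \<notin> {1 + inverse (real (Suc n))<..}"
      by (rule AE_not_in) (simp add: null_sets_def emeasure_eq_measure r[OF p] del: of_nat_Suc)
    moreover have "AE x in P. x \<notin> {..<- inverse (real (Suc n))}"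
      by (rule AE_not_in) (simp add: null_sets_def emeasure_eq_measure l[OF p] del: of_nat_Suc)
    ultimately show "AE x in P. x \<notin> {1 + inverse (real (Suc n))<..} \<and> x \<notin> {..<- inverse (real (Suc n))}"
      by eventually_elim simp
  qed
  then show ?thesis
  proof eventually_elim
    case (elim x)
    then have bounds: "x \<le> 1 + inverse (real (Suc n))" "- inverse (real (Suc n)) \<le> x" for n
      by (auto simp: not_less)
    have "x \<le> 1 + e" "- e \<le> x" if e: "e > 0" for e
    proof -
      obtain n where "inverse (real (Suc n)) < e"
        using reals_Archimedean[OF e] by blast
      then show "x \<le> 1 + e" "- e \<le> x"
        using bounds[of n] by linarith+
    qed
    then have "x \<le> 1" "0 \<le> x"
      using field_le_epsilon[of x 1] field_le_epsilon[of 0 x] by (force simp: minus_le_iff)+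
    then show ?case by simp
  qed
qed

lemma integrable_continuous:
  fixes f :: "real \<Rightarrow> real"
  assumes "continuous_on UNIV f"
  shows "integrable P f"
proof -
  have "compact (f ` {0..1})"
    by (rule compact_continuous_image[OF continuous_on_subset[OF assms]]) auto
  then obtain b where "\<forall>y\<in>f ` {0..1}. norm y \<le> b"
    using compact_imp_bounded bounded_iff by metis
  then have b: "norm (f x) \<le> b" if "0 \<le> x \<and> x \<le> 1" for x
    using that by auto
  have "AE x in P. norm (f x) \<le> b"
    using AE_unit_interval by eventually_elim (rule b)
  moreover have "f \<in> borel_measurable borel"
    using assms by (rule borel_measurable_continuous_onI)
  ultimately show ?thesis
    by (intro integrable_const_bound[of _ b]) auto
qed

text \<open>Since \<open>P\<close> lives on \<open>[0, 1]\<close>, continuous integrands are compared there only. This is how the support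
of \<open>P\<close> is used below.\<close>

lemma integral_mono_unit:
  fixes f g :: "real \<Rightarrow> real"
  assumes "continuous_on UNIV f" "continuous_on UNIV g"
    and "\<And>x. 0 \<le> x \<Longrightarrow> x \<le> 1 \<Longrightarrow> f x \<le> g x"
  shows "(\<integral>x. f x \<partial>P) \<le> (\<integral>x. g x \<partial>P)"
  by (rule integral_mono_AE[OF integrable_continuous integrable_continuous])
    (use assms AE_unit_interval in auto)

lemma integral_cong_unit:
  fixes f g :: "real \<Rightarrow> real"
  assumes "continuous_on UNIV f" "continuous_on UNIV g"
    and "\<And>x. 0 \<le> x \<Longrightarrow> x \<le> 1 \<Longrightarrow> f x = g x"
  shows "(\<integral>x. f x \<partial>P) = (\<integral>x. g x \<partial>P)"
  by (intro antisym integral_mono_unit) (use assms in auto)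

lemma S_continuous: "continuous_on UNIV S1" "continuous_on UNIV S2"
  unfolding S1_def[abs_def] S2_def[abs_def] by (intro continuous_intros)+

lemma integral_self_similar:
  fixes f :: "real \<Rightarrow> real"
  assumes f: "continuous_on UNIV f"
  shows "(\<integral>x. f x \<partial>P) = 1/2 * (\<integral>x. f (S1 x) \<partial>P) + 1/2 * (\<integral>x. f (S2 x) \<partial>P)"
proof -
  have comp: "continuous_on UNIV (\<lambda>x. g (S1 x))" "continuous_on UNIV (\<lambda>x. g (S2 x))"
    if "continuous_on UNIV g" for g :: "real \<Rightarrow> real"
    using continuous_on_compose2[OF that S_continuous(1)] continuous_on_compose2[OF that S_continuous(2)]
    by auto
  have nonneg: "2 * (\<integral>x. g x \<partial>P) = (\<integral>x. g (S1 x) \<partial>P) + (\<integral>x. g (S2 x) \<partial>P)"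
    if g: "continuous_on UNIV g" and "\<And>x. 0 \<le> g x" for g :: "real \<Rightarrow> real"
  proof -
    have eq: "ennreal (\<integral>x. h x \<partial>P) = (\<integral>\<^sup>+x. ennreal (h x) \<partial>P)"
      if "continuous_on UNIV h" "\<And>x. 0 \<le> h x" for h :: "real \<Rightarrow> real"
      using that by (subst nn_integral_eq_integral) (auto intro: integrable_continuous)
    have "(\<lambda>x. ennreal (g x)) \<in> borel_measurable borel"
      using borel_measurable_continuous_onI[OF g] by measurable
    from nn_integral_self_similar[OF this]
    have "ennreal (2 * (\<integral>x. g x \<partial>P)) = ennreal ((\<integral>x. g (S1 x) \<partial>P) + (\<integral>x. g (S2 x) \<partial>P))"
      using that comp[OF g] by (simp add: eq ennreal_mult ennreal_plus flip: eq)
    then show ?thesis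
      by (subst (asm) ennreal_inj) (auto intro!: integral_nonneg_AE add_nonneg_nonneg simp: that)
  qed
  let ?p = "\<lambda>x. max 0 (f x)" and ?n = "\<lambda>x. max 0 (- f x)"
  have c: "continuous_on UNIV ?p" "continuous_on UNIV ?n"
    using f by (auto intro!: continuous_intros)
  have split: "(\<integral>x. h x \<partial>P) = (\<integral>x. max 0 (h x) \<partial>P) - (\<integral>x. max 0 (- h x) \<partial>P)"
    if "continuous_on UNIV h" for h :: "real \<Rightarrow> real"
  proof -
    have "(\<integral>x. h x \<partial>P) = (\<integral>x. max 0 (h x) - max 0 (- h x) \<partial>P)"
      by (rule Bochner_Integration.integral_cong) auto
    also have "\<dots> = (\<integral>x. max 0 (h x) \<partial>P) - (\<integral>x. max 0 (- h x) \<partial>P)"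
      using that by (intro Bochner_Integration.integral_diff integrable_continuous continuous_intros)
    finally show ?thesis .
  qed
  show ?thesis
    using nonneg[OF c(1)] nonneg[OF c(2)]
      split[OF f] split[OF comp(1)[OF f]] split[OF comp(2)[OF f]] by (simp add: field_simps)
qed

text \<open>Self-similarity turns each moment into a linear equation for itself.\<close>

lemma mean_half: "(\<integral>x. x \<partial>P) = 1/2"
proof -
  have i: "integrable P (\<lambda>x. x)" by (rule integrable_continuous) (rule continuous_intros)
  have "(\<integral>x. x \<partial>P) = 1/2 * (4/9 * (\<integral>x. x \<partial>P)) + 1/2 * (4/9 * (\<integral>x. x \<partial>P) + 5/9)"
    using integral_self_similar[of "\<lambda>x. x"] i
    by (simp add: S1_def S2_def continuous_intros)
  then show ?thesis by (simp add: field_simps)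
qed

lemma integral_quadratic_second_moment:
  "(\<integral>x. a * (x - 1/2)\<^sup>2 + b * (x - 1/2) + c \<partial>P) = a * (\<integral>x. (x - 1/2)\<^sup>2 \<partial>P) + c"
proof -
  have i: "integrable P (\<lambda>x. (x - 1/2)\<^sup>2)" "integrable P (\<lambda>x. x)"
    by (intro integrable_continuous continuous_intros)+
  then have "(\<integral>x. x - 1/2 \<partial>P) = 0"
    by (simp add: mean_half)
  then show ?thesis
    using i by simp
qed

lemma second_moment: "(\<integral>x. (x - 1/2)\<^sup>2 \<partial>P) = 5/52"
proof -
  let ?V = "\<integral>x. (x - 1/2)\<^sup>2 \<partial>P"
  have "?V = 1/2 * (\<integral>x. (S1 x - 1/2)\<^sup>2 \<partial>P) + 1/2 * (\<integral>x. (S2 x - 1/2)\<^sup>2 \<partial>P)"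
    by (rule integral_self_similar) (intro continuous_intros)
  also have "(\<integral>x. (S1 x - 1/2)\<^sup>2 \<partial>P) = 16/81 * ?V + 25/324"
    by (subst integral_quadratic_second_moment[symmetric, where b = "-20/81"], rule Bochner_Integration.integral_cong)
      (auto simp: S1_def power2_eq_square field_simps)
  also have "(\<integral>x. (S2 x - 1/2)\<^sup>2 \<partial>P) = 16/81 * ?V + 25/324"
    by (subst integral_quadratic_second_moment[symmetric, where b = "20/81"], rule Bochner_Integration.integral_cong)
      (auto simp: S2_def power2_eq_square field_simps)
  finally show ?thesis by simp
qed

lemma integral_quadratic:
  "(\<integral>x. a * (x - 1/2)\<^sup>2 + b * (x - 1/2) + c \<partial>P) = a * (5/52) + c"
  using integral_quadratic_second_moment by (simp add: second_moment)

end

section \<open>An explicit bound for the base window\<close>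

text \<open>An upper bound for the integral of \<open>(9/16)\<^sup>2 - (x - t)\<^sup>2\<close>, truncated at 0, over one of the four
cylinders of level 2 (normalised to mass 1), in terms of the distance \<open>y\<close> from \<open>t\<close> to its centre.
Such a cylinder has half-width \<open>8/81\<close> and variance \<open>(16/81)\<^sup>2 * 5/52\<close>. The three cases are: cylinder
inside the window, cut by its boundary, and outside. The middle case adds to the untruncated integral
half of the amount by which the integrand is negative at the far end of the cylinder.\<close>

definition cap :: "real \<Rightarrow> real" where
  "cap y =
    (if y \<le> 9/16 - 8/81 then (9/16)\<^sup>2 - y\<^sup>2 - (16/81)\<^sup>2 * (5/52)
     else if y \<le> 9/16 + 8/81 then ((9/16)\<^sup>2 - y\<^sup>2) / 2 + 8/81 * y + (8/81)\<^sup>2 / 2 - (16/81)\<^sup>2 * (5/52)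
     else 0)"

definition cap_sum :: "real \<Rightarrow> real" where
  "cap_sum t = 1/4 * (cap \<bar>t - 8/81\<bar> + cap \<bar>t - 28/81\<bar> + cap \<bar>t - 53/81\<bar> + cap \<bar>t - 73/81\<bar>)"

lemma cap_nonneg: "0 \<le> y \<Longrightarrow> 0 \<le> cap y"
proof -
  assume y: "0 \<le> y"
  consider "y \<le> 9/16 - 8/81" | "9/16 - 8/81 < y" "y \<le> 9/16 + 8/81" | "9/16 + 8/81 < y"
    by linarith
  then show ?thesis
  proof cases
    case 1
    have "y\<^sup>2 \<le> (9/16 - 8/81)\<^sup>2" using 1 y by (intro power_mono) auto
    then show ?thesis using 1 by (simp add: cap_def power2_eq_square)
  next
    case 2
    have "(y - 8/81)\<^sup>2 \<le> (9/16)\<^sup>2" using 2 by (intro power_mono) auto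
    moreover have "cap y = ((9/16)\<^sup>2 - (y - 8/81)\<^sup>2) / 2 + (8/81)\<^sup>2 - (16/81)\<^sup>2 * (5/52)"
      using 2 by (simp add: cap_def power2_eq_square field_simps)
    ultimately show ?thesis by (simp add: power2_eq_square)
  next
    case 3
    then show ?thesis by (simp add: cap_def)
  qed
qed

lemma cap_sum_nonneg: "0 \<le> cap_sum t"
  unfolding cap_sum_def by (simp add: cap_nonneg)

lemma cap_sum_reflect: "cap_sum (1 - t) = cap_sum t"
proof -
  have "\<bar>1 - t - 8/81\<bar> = \<bar>t - 73/81\<bar>" "\<bar>1 - t - 28/81\<bar> = \<bar>t - 53/81\<bar>"
    "\<bar>1 - t - 53/81\<bar> = \<bar>t - 28/81\<bar>" "\<bar>1 - t - 73/81\<bar> = \<bar>t - 8/81\<bar>" by linarith+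
  then show ?thesis unfolding cap_sum_def by simp
qed

lemma cap_sum_zero_left: "t < - 9/16 \<Longrightarrow> cap_sum t = 0"
  by (simp add: cap_sum_def cap_def abs_if)

text \<open>All four cylinders are inside the window here, so the parabola is exact. Near \<open>1/2\<close> no slack is left,
which makes this case separate from the estimates below.\<close>

lemma cap_sum_near:
  assumes "1/2 \<le> t" "t \<le> 9/16"
  shows "cap_sum t = 81/256 - 5/52 - (t - 1/2)\<^sup>2"
  using assms by (simp add: cap_sum_def cap_def abs_if power2_eq_square algebra_simps)

text \<open>The numerical heart: two cylinders at distance \<open>5/4\<close>, as the halves of a common parent are after
rescaling, together save strictly less than one of them does from its midpoint. The bound \<open>9/8\<close> is the middle
of the gap, and positions beyond it follow by reflection. The case boundaries are the
values of \<open>t\<close> at which one end of the window \<open>[t - 9/16, t + 9/16]\<close> meets an end of one of the eight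
cylinders of level 2. Between them the sum is a concave quadratic, and completing the square shows a
positive remainder.\<close>

lemma cap_sum_core:
  assumes "1/2 < t" "t \<le> 9/8"
  shows "cap_sum t + cap_sum (t - 5/4) < 81/256 - 5/52"
proof -
  note [simp] = cap_sum_def cap_def abs_if power2_eq_square
  consider "t \<le> 9/16" | "9/16 < t" "t < 11/16" | "11/16 \<le> t" "t \<le> 9/16 + 16/81"
    | "9/16 + 16/81 < t" "t \<le> 9/16 + 20/81" | "9/16 + 20/81 < t" "t < 11/16 + 16/81"
    | "11/16 + 16/81 \<le> t" "t < 11/16 + 20/81" | "11/16 + 20/81 \<le> t" "t \<le> 9/16 + 36/81"
    | "9/16 + 36/81 < t" "t \<le> 9/16 + 45/81" | "9/16 + 45/81 < t"
    by linarith
  then show ?thesis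
  proof cases
    case 1
    have "0 < (t - 1/2)\<^sup>2" using assms by simp
    then show ?thesis
      using cap_sum_near[of t] cap_sum_zero_left[of "t - 5/4"] assms 1 by simp
  next
    case 2
    then have "cap_sum t + cap_sum (t - 5/4) = 81/256 - 5/52 - (7/8 * (t - 4/7)\<^sup>2 + 55/14336)"
      by (simp add: field_simps)
    then show ?thesis using zero_le_power2[of "t - 4/7"] by linarith
  next
    case 3
    with assms have "cap_sum t + cap_sum (t - 5/4) = 81/256 - 5/52 - (1 * (t - 21/32)\<^sup>2 + 1148323/87340032)"
      by (simp add: field_simps)
    then show ?thesis using zero_le_power2[of "t - 21/32"] by linarith
  next
    case 4
    with assms have "cap_sum t + cap_sum (t - 5/4) = 81/256 - 5/52 - (7/8 * (t - 1637/2268)\<^sup>2 + 2270455/94058496)"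
      by (simp add: field_simps)
    then show ?thesis using zero_le_power2[of "t - 1637/2268"] by linarith
  next
    case 5
    with assms have "cap_sum t + cap_sum (t - 5/4) = 81/256 - 5/52 - (3/4 * (t - 173/216)\<^sup>2 + 206957/6718464)"
      by (simp add: field_simps)
    then show ?thesis using zero_le_power2[of "t - 173/216"] by linarith
  next
    case 6
    with assms have "cap_sum t + cap_sum (t - 5/4) = 81/256 - 5/52 - (7/8 * (t - 1013/1134)\<^sup>2 + 3390775/94058496)"
      by (simp add: field_simps)
    then show ?thesis using zero_le_power2[of "t - 1013/1134"] by linarith
  next
    case 7
    with assms have "cap_sum t + cap_sum (t - 5/4) = 81/256 - 5/52 - (1 * (t - 31/32)\<^sup>2 + 3043723/87340032)"
      by (simp add: field_simps)
    then show ?thesis using zero_le_power2[of "t - 31/32"] by linarith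
  next
    case 8
    with assms have "cap_sum t + cap_sum (t - 5/4) = 81/256 - 5/52 - (7/8 * (t - 263/252)\<^sup>2 + 42535/1161216)"
      by (simp add: field_simps)
    then show ?thesis using zero_le_power2[of "t - 263/252"] by linarith
  next
    case 9
    with assms have "cap_sum t + cap_sum (t - 5/4) = 81/256 - 5/52 - (3/4 * (t - 9/8)\<^sup>2 + 3437/82944)"
      by (simp add: field_simps)
    then show ?thesis using zero_le_power2[of "t - 9/8"] by linarith
  qed
qed

section \<open>The overlap of a window with the measure\<close>

context cantor_measure begin

text \<open>What a point \<open>t\<close> can save at most when the squared distances are compared with the constant \<open>\<rho>\<^sup>2\<close>.\<close>

definition overlap :: "real \<Rightarrow> real \<Rightarrow> real" where
  "overlap \<rho> t = (\<integral>x. max 0 (\<rho>\<^sup>2 - (x - t)\<^sup>2) \<partial>P)"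

text \<open>In the cut case the negative part of the integrand is convex in \<open>x\<close>, hence lies below the chord
between its values at the two ends of the cylinder. It vanishes at the near end, so the mean of the
chord is half the value at the far end.\<close>

lemma piece_le_cap:
  "(\<integral>x. max 0 ((9/16)\<^sup>2 - (d + 16/81 * (x - 1/2))\<^sup>2) \<partial>P) \<le> cap \<bar>d\<bar>"
  (is "?I \<le> _")
proof -
  consider "\<bar>d\<bar> \<le> 9/16 - 8/81" | "9/16 - 8/81 < \<bar>d\<bar>" "\<bar>d\<bar> \<le> 9/16 + 8/81"
    | "9/16 + 8/81 < \<bar>d\<bar>"
    by linarith
  then show ?thesis
  proof cases
    case 1
    have "?I \<le> (\<integral>x. (- (16/81)\<^sup>2) * (x - 1/2)\<^sup>2 + (- 32/81 * d) * (x - 1/2) + ((9/16)\<^sup>2 - d\<^sup>2) \<partial>P)"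
    proof (rule integral_mono_unit)
      fix x :: real assume x: "0 \<le> x" "x \<le> 1"
      have "\<bar>16/81 * (x - 1/2)\<bar> \<le> 8/81" using x by (simp add: abs_le_iff)
      then have "\<bar>d + 16/81 * (x - 1/2)\<bar> \<le> 9/16" using 1 by linarith
      then have "\<bar>d + 16/81 * (x - 1/2)\<bar>\<^sup>2 \<le> (9/16)\<^sup>2"
        by (intro power_mono) auto
      then have "max 0 ((9/16)\<^sup>2 - (d + 16/81 * (x - 1/2))\<^sup>2) = (9/16)\<^sup>2 - (d + 16/81 * (x - 1/2))\<^sup>2"
        by simp
      also have "\<dots> = (- (16/81)\<^sup>2) * (x - 1/2)\<^sup>2 + (- 32/81 * d) * (x - 1/2) + ((9/16)\<^sup>2 - d\<^sup>2)"
        by (simp add: power2_eq_square field_simps)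
      finally show "max 0 ((9/16)\<^sup>2 - (d + 16/81 * (x - 1/2))\<^sup>2) \<le> \<dots>"
        by simp
    qed (intro continuous_intros)+
    then show ?thesis
      unfolding integral_quadratic using 1 by (simp add: cap_def)
  next
    case 2
    let ?D = "\<bar>d\<bar>" and ?s = "sgn d"
    let ?k = "(?D + 8/81)\<^sup>2 - (9/16)\<^sup>2"
    have d: "d = ?s * ?D" "?s * ?s = 1"
      using 2 by (auto simp: sgn_if)
    have "?I \<le> (\<integral>x. (- (16/81)\<^sup>2) * (x - 1/2)\<^sup>2 + (- 32/81 * d + ?k * ?s) * (x - 1/2)
        + ((9/16)\<^sup>2 - d\<^sup>2 + ?k / 2) \<partial>P)"
    proof (rule integral_mono_unit)
      fix x :: real assume x: "0 \<le> x" "x \<le> 1"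
      let ?z = "d + 16/81 * (x - 1/2)"
      \<comment> \<open>\<open>w\<close> runs from 0 at the end of the cylinder near the window centre to 1 at the far end.\<close>
      define w where "w = 1/2 + ?s * (x - 1/2)"
      have w: "0 \<le> w" "w \<le> 1" using x by (auto simp: w_def sgn_if)
      have "?z = ?s * (?D + 16/81 * (w - 1/2))"
        using d by (simp add: w_def distrib_left mult.left_commute flip: mult.assoc)
      then have "?z\<^sup>2 = (?s * ?s) * (?D + 16/81 * (w - 1/2))\<^sup>2"
        by (simp add: power2_eq_square)
      then have z: "?z\<^sup>2 = (?D + 16/81 * (w - 1/2))\<^sup>2"
        using d(2) by simp
      have "(9/16)\<^sup>2 \<le> (?D + 8/81)\<^sup>2" "(?D - 8/81)\<^sup>2 \<le> (9/16)\<^sup>2"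
        using 2 by (intro power_mono; simp)+
      then have a: "0 \<le> w * ?k" "0 \<le> (1 - w) * ((9/16)\<^sup>2 - (?D - 8/81)\<^sup>2)"
        using w by (auto intro!: mult_nonneg_nonneg)
      have "0 \<le> (16/81)\<^sup>2 * (w * (1 - w))" using w by simp
      moreover have "?z\<^sup>2 - (9/16)\<^sup>2 = w * ?k - (1 - w) * ((9/16)\<^sup>2 - (?D - 8/81)\<^sup>2) - (16/81)\<^sup>2 * (w * (1 - w))"
        unfolding z by (simp add: power2_eq_square field_simps)
      ultimately have "?z\<^sup>2 - (9/16)\<^sup>2 \<le> w * ?k"
        using a by linarith
      then have "max 0 ((9/16)\<^sup>2 - ?z\<^sup>2) \<le> (9/16)\<^sup>2 - ?z\<^sup>2 + w * ?k"
        using a by simp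
      also have "\<dots> = (- (16/81)\<^sup>2) * (x - 1/2)\<^sup>2 + (- 32/81 * d + ?k * ?s) * (x - 1/2)
        + ((9/16)\<^sup>2 - d\<^sup>2 + ?k / 2)"
        by (simp add: w_def power2_eq_square field_simps)
      finally show "max 0 ((9/16)\<^sup>2 - ?z\<^sup>2) \<le> \<dots>" .
    qed (intro continuous_intros)+
    then show ?thesis
      unfolding integral_quadratic using 2 by (simp add: cap_def power2_eq_square field_simps)
  next
    case 3
    have "?I \<le> (\<integral>x. 0 \<partial>P)"
    proof (rule integral_mono_unit)
      fix x :: real assume x: "0 \<le> x" "x \<le> 1"
      have "\<bar>16/81 * (x - 1/2)\<bar> \<le> 8/81" using x by (simp add: abs_le_iff)
      then have "9/16 \<le> \<bar>d + 16/81 * (x - 1/2)\<bar>" using 3 by linarith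
      then have "(9/16)\<^sup>2 \<le> \<bar>d + 16/81 * (x - 1/2)\<bar>\<^sup>2"
        by (intro power_mono) auto
      then show "max 0 ((9/16)\<^sup>2 - (d + 16/81 * (x - 1/2))\<^sup>2) \<le> 0" by simp
    qed (intro continuous_intros)+
    then show ?thesis using 3 by (simp add: cap_def)
  qed
qed

lemma overlap_le_cap_sum: "overlap (9/16) t \<le> cap_sum t"
proof -
  let ?f = "\<lambda>x. max 0 ((9/16)\<^sup>2 - (x - t)\<^sup>2)"
  let ?g = "\<lambda>d x. max 0 ((9/16)\<^sup>2 - (d + 16/81 * (x - 1/2))\<^sup>2)"
  have e: "S1 (S1 x) - t = (8/81 - t) + 16/81 * (x - 1/2)" "S1 (S2 x) - t = (28/81 - t) + 16/81 * (x - 1/2)"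
    "S2 (S1 x) - t = (53/81 - t) + 16/81 * (x - 1/2)" "S2 (S2 x) - t = (73/81 - t) + 16/81 * (x - 1/2)" for x
    by (simp_all add: S1_def S2_def field_simps)
  have "overlap (9/16) t = 1/2 * (\<integral>x. ?f (S1 x) \<partial>P) + 1/2 * (\<integral>x. ?f (S2 x) \<partial>P)"
    unfolding overlap_def by (rule integral_self_similar) (intro continuous_intros)
  also have "(\<integral>x. ?f (S1 x) \<partial>P) = 1/2 * (\<integral>x. ?f (S1 (S1 x)) \<partial>P) + 1/2 * (\<integral>x. ?f (S1 (S2 x)) \<partial>P)"
    unfolding S1_def by (rule integral_self_similar[unfolded S1_def]) (intro continuous_intros)
  also have "(\<integral>x. ?f (S2 x) \<partial>P) = 1/2 * (\<integral>x. ?f (S2 (S1 x)) \<partial>P) + 1/2 * (\<integral>x. ?f (S2 (S2 x)) \<partial>P)"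
    unfolding S2_def by (rule integral_self_similar[unfolded S2_def]) (intro continuous_intros)
  also have "(\<lambda>x. ?f (S1 (S1 x))) = ?g (8/81 - t)" by (simp only: e)
  also have "(\<lambda>x. ?f (S1 (S2 x))) = ?g (28/81 - t)" by (simp only: e)
  also have "(\<lambda>x. ?f (S2 (S1 x))) = ?g (53/81 - t)" by (simp only: e)
  also have "(\<lambda>x. ?f (S2 (S2 x))) = ?g (73/81 - t)" by (simp only: e)
  finally have split: "overlap (9/16) t = 1/2 * (1/2 * (\<integral>x. ?g (8/81 - t) x \<partial>P) + 1/2 * (\<integral>x. ?g (28/81 - t) x \<partial>P))
      + 1/2 * (1/2 * (\<integral>x. ?g (53/81 - t) x \<partial>P) + 1/2 * (\<integral>x. ?g (73/81 - t) x \<partial>P))" .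
  have quarter: "o' = 1/2 * (1/2 * a + 1/2 * b) + 1/2 * (1/2 * c + 1/2 * d) \<Longrightarrow> a \<le> a' \<Longrightarrow> b \<le> b'
      \<Longrightarrow> c \<le> c' \<Longrightarrow> d \<le> d' \<Longrightarrow> o' \<le> 1/4 * (a' + b' + c' + d')" for o' a b c d a' b' c' d' :: real
    by (simp add: field_simps)
  show ?thesis
    using split piece_le_cap[of "8/81 - t"] piece_le_cap[of "28/81 - t"]
      piece_le_cap[of "53/81 - t"] piece_le_cap[of "73/81 - t"]
    unfolding cap_sum_def abs_minus_commute[of t] by (rule quarter)
qed

text \<open>The two halves of \<open>P\<close> seen from \<open>t\<close>, each rescaled to the whole. The factor is mass \<open>1/2\<close> times
\<open>16/81\<close> for the squared lengths.\<close>

lemma overlap_scale: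
  "overlap (4/9 * \<rho>) t = 8/81 * (overlap \<rho> (9/4 * t) + overlap \<rho> (9/4 * t - 5/4))"
proof -
  let ?f = "\<lambda>x. max 0 ((4/9 * \<rho>)\<^sup>2 - (x - t)\<^sup>2)"
  have s: "max 0 (16/81 * y) = 16/81 * max 0 y" for y :: real by auto
  have "overlap (4/9 * \<rho>) t = 1/2 * (\<integral>x. ?f (S1 x) \<partial>P) + 1/2 * (\<integral>x. ?f (S2 x) \<partial>P)"
    unfolding overlap_def by (rule integral_self_similar) (intro continuous_intros)
  also have "(\<lambda>x. ?f (S1 x)) = (\<lambda>x. 16/81 * max 0 (\<rho>\<^sup>2 - (x - 9/4 * t)\<^sup>2))"
    unfolding s[symmetric] by (auto simp: S1_def power2_eq_square algebra_simps)
  also have "(\<lambda>x. ?f (S2 x)) = (\<lambda>x. 16/81 * max 0 (\<rho>\<^sup>2 - (x - (9/4 * t - 5/4))\<^sup>2))"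
    unfolding s[symmetric] by (auto simp: S2_def power2_eq_square algebra_simps)
  finally show ?thesis
    by (simp add: overlap_def)
qed

lemma overlap_zero:
  assumes "0 \<le> \<rho>" "t \<le> - \<rho> \<or> 1 + \<rho> \<le> t"
  shows "overlap \<rho> t = 0"
proof -
  have "overlap \<rho> t = (\<integral>x. 0 \<partial>P)"
    unfolding overlap_def
  proof (rule integral_cong_unit)
    fix x :: real assume x: "0 \<le> x" "x \<le> 1"
    have "\<rho>\<^sup>2 \<le> \<bar>x - t\<bar>\<^sup>2"
      using assms x by (intro power_mono) auto
    then show "max 0 (\<rho>\<^sup>2 - (x - t)\<^sup>2) = 0" by simp
  qed (intro continuous_intros)+
  then show ?thesis by simp
qed

lemma overlap_mono_right: "1 \<le> t \<Longrightarrow> t \<le> s \<Longrightarrow> overlap \<rho> s \<le> overlap \<rho> t"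
  unfolding overlap_def
proof (rule integral_mono_unit)
  fix x :: real assume x: "0 \<le> x" "x \<le> 1" and "1 \<le> t" "t \<le> s"
  then have "(t - x)\<^sup>2 \<le> (s - x)\<^sup>2" by (intro power_mono) auto
  then show "max 0 (\<rho>\<^sup>2 - (x - s)\<^sup>2) \<le> max 0 (\<rho>\<^sup>2 - (x - t)\<^sup>2)"
    by (simp add: power2_commute)
qed (intro continuous_intros)+

lemma overlap_mono_left: "t \<le> 0 \<Longrightarrow> s \<le> t \<Longrightarrow> overlap \<rho> s \<le> overlap \<rho> t"
  unfolding overlap_def
proof (rule integral_mono_unit)
  fix x :: real assume x: "0 \<le> x" "x \<le> 1" and "t \<le> 0" "s \<le> t"
  then have "(x - t)\<^sup>2 \<le> (x - s)\<^sup>2" by (intro power_mono) auto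
  then show "max 0 (\<rho>\<^sup>2 - (x - s)\<^sup>2) \<le> max 0 (\<rho>\<^sup>2 - (x - t)\<^sup>2)"
    by simp
qed (intro continuous_intros)+

end

section \<open>The overlap is largest at the cylinder midpoints\<close>

definition radius :: "nat \<Rightarrow> real" where
  "radius k = (4/9)^k * (9/16)"

text \<open>The maximum of the overlap for the window of level \<open>k\<close>, by \<open>overlap_grid\<close> below. For \<open>k = 0\<close> it is the
integral of \<open>(9/16)\<^sup>2 - (x - 1/2)\<^sup>2\<close>.\<close>

definition gain :: "nat \<Rightarrow> real" where
  "gain k = (8/81)^k * (81/256 - 5/52)"

lemma radius_0: "radius 0 = 9/16"
  by (simp add: radius_def)

lemma radius_Suc: "radius (Suc k) = 4/9 * radius k"
  by (simp add: radius_def)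

lemma gain_0: "gain 0 = 81/256 - 5/52"
  by (simp add: gain_def)

lemma gain_Suc: "gain (Suc k) = 8/81 * gain k"
  by (simp add: gain_def)

lemma gain_pos: "0 < gain k"
  by (simp add: gain_def)

text \<open>The bookkeeping identity behind the value of the optimal distortion: when \<open>2\<^sup>k\<close> points save the
maximal amount each, exactly \<open>(16/81)\<^sup>k * V\<close> is left of \<open>\<rho>\<^sub>k\<^sup>2\<close>.\<close>

lemma radius_squared: "(radius k)\<^sup>2 = (16/81)^k * (5/52) + 2^k * gain k"
  by (induction k) (simp_all add: radius_0 gain_0 radius_Suc gain_Suc power_mult_distrib field_simps)

context cantor_measure begin

lemma overlap_less:
  assumes "t \<noteq> 1/2"
  shows "overlap (9/16) t < 81/256 - 5/52"
proof -
  have core: "overlap (9/16) s < 81/256 - 5/52" if "1/2 < s" "s \<le> 9/8" for s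
    using cap_sum_core[OF that] cap_sum_nonneg[of "s - 5/4"] overlap_le_cap_sum[of s] by linarith
  have core': "overlap (9/16) s < 81/256 - 5/52" if "-1/8 \<le> s" "s < 1/2" for s
    using cap_sum_core[of "1 - s"] that cap_sum_nonneg[of "1 - s - 5/4"] overlap_le_cap_sum[of s]
      cap_sum_reflect[of s] by linarith
  \<comment> \<open>\<open>9/8\<close> and its mirror image \<open>-1/8\<close> bound the range of \<open>cap_sum_core\<close>; beyond them the overlap
    decreases.\<close>
  consider "t < -1/8" | "-1/8 \<le> t" "t < 1/2" | "1/2 < t" "t \<le> 9/8" | "9/8 < t"
    using assms by linarith
  then show ?thesis
  proof cases
    case 1
    then show ?thesis using core'[of "-1/8"] overlap_mono_left[of "-1/8" t "9/16"] by simp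
  next
    case 4
    then show ?thesis using core[of "9/8"] overlap_mono_right[of "9/8" t "9/16"] by simp
  qed (use core[of t] core'[of t] in auto)
qed

lemma overlap_le: "overlap (9/16) t \<le> 81/256 - 5/52"
proof (cases "t = 1/2")
  case True
  show ?thesis
    using overlap_le_cap_sum[of "1/2"] cap_sum_near[of "1/2"] unfolding True by simp
qed (use overlap_less[of t] in simp)

text \<open>The two exceptional values are the midpoints of the two cylinders: \<open>7/4 - 5/4 = 1/2\<close>.\<close>

lemma overlap_pair_less:
  assumes "t \<noteq> 1/2" "t \<noteq> 7/4"
  shows "overlap (9/16) t + overlap (9/16) (t - 5/4) < 81/256 - 5/52"
proof -
  \<comment> \<open>The window meets both copies only if \<open>5/4 - 9/16 < t < 1 + 9/16\<close>; \<open>9/8\<close> is the centre of symmetry.\<close>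
  consider "t \<le> 11/16" | "11/16 < t" "t \<le> 9/8" | "9/8 < t" "t < 25/16" | "25/16 \<le> t"
    by linarith
  then show ?thesis
  proof cases
    case 1
    then show ?thesis
      using overlap_zero[of "9/16" "t - 5/4"] overlap_less[OF assms(1)] by simp
  next
    case 2
    then show ?thesis
      using overlap_le_cap_sum[of t] overlap_le_cap_sum[of "t - 5/4"] cap_sum_core[of t] by linarith
  next
    case 3
    have "cap_sum t = cap_sum (9/4 - t - 5/4)" "cap_sum (t - 5/4) = cap_sum (9/4 - t)"
      using cap_sum_reflect[of t] cap_sum_reflect[of "t - 5/4"] by (simp_all add: algebra_simps)
    then show ?thesis
      using 3 overlap_le_cap_sum[of t] overlap_le_cap_sum[of "t - 5/4"] cap_sum_core[of "9/4 - t"]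
      by linarith
  next
    case 4
    then show ?thesis
      using overlap_zero[of "9/16" t] overlap_less[of "t - 5/4"] assms(2) by simp
  qed
qed

text \<open>From outside \<open>[0, 1]\<close> only the nearer half is ever within reach, so the recursion has one term and
rescales all the way down to the base window.\<close>

lemma overlap_outside:
  assumes "0 \<le> d"
  shows overlap_right: "overlap (radius k) (1 + d) = (8/81)^k * overlap (9/16) (1 + (9/4)^k * d)"
    and overlap_left: "overlap (radius k) (- d) = (8/81)^k * overlap (9/16) (- ((9/4)^k * d))"
proof -
  have small: "0 \<le> radius k" "radius k \<le> 9/16" for k
    by (simp_all add: radius_def power_le_one)
  show "overlap (radius k) (1 + d) = (8/81)^k * overlap (9/16) (1 + (9/4)^k * d)"
    using assms
  proof (induction k arbitrary: d)
    case (Suc k)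
    have "overlap (radius (Suc k)) (1 + d)
        = 8/81 * (overlap (radius k) (9/4 * (1 + d)) + overlap (radius k) (1 + 9/4 * d))"
      using overlap_scale[of "radius k" "1 + d"] by (simp add: radius_Suc add.commute[of 1] distrib_left)
    also have "overlap (radius k) (9/4 * (1 + d)) = 0"
      using small[of k] Suc.prems by (intro overlap_zero) auto
    also have "overlap (radius k) (1 + 9/4 * d) = (8/81)^k * overlap (9/16) (1 + (9/4)^k * (9/4 * d))"
      using Suc.prems by (intro Suc.IH) simp
    finally show ?case by (simp add: mult_ac)
  qed (simp add: radius_0)
  show "overlap (radius k) (- d) = (8/81)^k * overlap (9/16) (- ((9/4)^k * d))"
    using assms
  proof (induction k arbitrary: d)
    case (Suc k)
    have "overlap (radius (Suc k)) (- d)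
        = 8/81 * (overlap (radius k) (- (9/4 * d)) + overlap (radius k) (- (9/4 * d) - 5/4))"
      using overlap_scale[of "radius k" "- d"] by (simp add: radius_Suc)
    also have "overlap (radius k) (- (9/4 * d) - 5/4) = 0"
      using small[of k] Suc.prems by (intro overlap_zero) auto
    also have "overlap (radius k) (- (9/4 * d)) = (8/81)^k * overlap (9/16) (- ((9/4)^k * (9/4 * d)))"
      using Suc.prems by (intro Suc.IH) simp
    finally show ?case by (simp add: mult_ac)
  qed (simp add: radius_0)
qed

end

definition grid :: "nat \<Rightarrow> real set" where
  "grid k = {S_word \<sigma> (1/2) | \<sigma>. \<sigma> \<in> words k}"

lemma grid_0: "grid 0 = {1/2}"
  by (auto simp: grid_def words_def)

lemma words_Suc: "words (Suc k) = Cons 1 ` words k \<union> Cons 2 ` words k"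
  by (auto simp: words_def length_Suc_conv)

lemma grid_image: "grid k = (\<lambda>\<sigma>. S_word \<sigma> (1/2)) ` words k"
  by (auto simp: grid_def)

lemma grid_Suc: "grid (Suc k) = S1 ` grid k \<union> S2 ` grid k"
  by (simp add: grid_image words_Suc image_Un image_image)

lemma finite_grid: "finite (grid k)"
  by (induction k) (simp_all add: grid_0 grid_Suc)

lemma grid_nonempty: "grid k \<noteq> {}"
  by (induction k) (simp_all add: grid_0 grid_Suc)

lemma card_grid_le: "card (grid k) \<le> 2 ^ k"
proof (induction k)
  case (Suc k)
  have "card (grid (Suc k)) \<le> card (S1 ` grid k) + card (S2 ` grid k)"
    unfolding grid_Suc by (rule card_Un_le)
  also have "\<dots> \<le> card (grid k) + card (grid k)"
    by (intro add_mono card_image_le finite_grid)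
  finally show ?case using Suc by simp
qed (simp add: grid_0)

context cantor_measure begin

text \<open>In the induction step the rescaled point \<open>s = 9/4 * t\<close> sees copies of the Cantor set on \<open>[0, 1]\<close> and
\<open>[5/4, 9/4]\<close>. If \<open>s\<close> is not strictly between them and \<open>k \<ge> 1\<close>, the copy farther from \<open>s\<close> is out of
reach, and the induction hypothesis concludes. If \<open>s\<close> is in the gap, both overlaps are seen from
outside and rescale to the base window. There the distances to the two copies have only grown, so the
pair estimate for level 0 applies. For \<open>k = 0\<close> the pair estimate applies directly.\<close>

lemma overlap_grid:
  "overlap (radius k) t \<le> gain k"
  "overlap (radius k) t = gain k \<Longrightarrow> t \<in> grid k"
proof -
  have "overlap (radius k) t < gain k
    \<or> overlap (radius k) t = gain k \<and> t \<in> grid k"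
  proof (induction k arbitrary: t)
    case 0
    then show ?case using overlap_less[of t] overlap_le[of t] by (auto simp: grid_0 radius_0 gain_0)
  next
    case (Suc k)
    let ?\<rho> = "radius k"
    let ?s = "9/4 * t"
    have rec: "overlap (radius (Suc k)) t = 8/81 * (overlap ?\<rho> ?s + overlap ?\<rho> (?s - 5/4))"
      using overlap_scale[of ?\<rho> t] by (simp add: radius_Suc)
    have t: "t = S1 ?s" "t = S2 (?s - 5/4)" by (simp_all add: S1_def S2_def algebra_simps)
    have far: "overlap ?\<rho> (1 + d) = 0" "overlap ?\<rho> (- d) = 0" if "1/4 \<le> d" "k \<noteq> 0" for d
    proof -
      \<comment> \<open>The gap \<open>1/4\<close>, magnified at least once, is as wide as the base window: \<open>9/4 * 1/4 = 9/16\<close>.\<close>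
      have "9/4 \<le> (9/4 :: real)^k"
        using self_le_power[of "9/4 :: real" k] that by simp
      then have "9/4 * (1/4) \<le> (9/4)^k * d"
        using that by (intro mult_mono) auto
      then show "overlap ?\<rho> (1 + d) = 0" "overlap ?\<rho> (- d) = 0"
        using that overlap_zero[of "9/16" "1 + (9/4)^k * d"] overlap_zero[of "9/16" "- ((9/4)^k * d)"]
        by (simp_all add: overlap_right overlap_left)
    qed
    have "overlap ?\<rho> ?s + overlap ?\<rho> (?s - 5/4) < gain k
      \<or> overlap ?\<rho> ?s + overlap ?\<rho> (?s - 5/4) = gain k \<and> t \<in> grid (Suc k)"
    proof -
      consider "k = 0" "?s = 1/2" | "k = 0" "?s = 7/4" | "k = 0" "?s \<noteq> 1/2" "?s \<noteq> 7/4"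
        | "k \<noteq> 0" "?s \<le> 1" | "k \<noteq> 0" "5/4 \<le> ?s" | "1 < ?s" "?s < 5/4"
        by linarith
      then show ?thesis
      proof cases
        case 1
        then show ?thesis
          using Suc.IH[of ?s] overlap_zero[of "9/16" "?s - 5/4"] t(1) by (auto simp: grid_Suc radius_0)
      next
        case 2
        then show ?thesis
          using Suc.IH[of "?s - 5/4"] overlap_zero[of "9/16" ?s] t(2) by (auto simp: grid_Suc radius_0)
      next
        case 3
        then show ?thesis using overlap_pair_less[of ?s] by (simp add: radius_0 gain_0)
      next
        case 4
        then show ?thesis
          using Suc.IH[of ?s] far(2)[of "5/4 - ?s"] t(1) by (auto simp: grid_Suc)
      next
        case 5
        then show ?thesis
          using Suc.IH[of "?s - 5/4"] far(1)[of "?s - 1"] t(2) by (auto simp: grid_Suc)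
      next
        case 6
        have one: "d \<le> (9/4)^k * d" if "0 \<le> d" for d :: real
          using mult_right_mono[of 1 "(9/4)^k" d] that by simp
        have grow: "?s - 1 \<le> (9/4)^k * (?s - 1)" "5/4 - ?s \<le> (9/4)^k * (5/4 - ?s)"
          by (intro one, use 6 in linarith)+
        have "overlap ?\<rho> ?s = (8/81)^k * overlap (9/16) (1 + (9/4)^k * (?s - 1))"
          using overlap_right[of "?s - 1" k] 6 by simp
        moreover have "overlap (9/16) (1 + (9/4)^k * (?s - 1)) \<le> overlap (9/16) ?s"
          by (rule overlap_mono_right) (use 6 grow in linarith)+
        moreover have "overlap ?\<rho> (?s - 5/4) = (8/81)^k * overlap (9/16) (- ((9/4)^k * (5/4 - ?s)))"
          using overlap_left[of "5/4 - ?s" k] 6 by simp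
        moreover have "overlap (9/16) (- ((9/4)^k * (5/4 - ?s))) \<le> overlap (9/16) (?s - 5/4)"
          by (rule overlap_mono_left) (use 6 grow in linarith)+
        ultimately have "overlap ?\<rho> ?s + overlap ?\<rho> (?s - 5/4)
            \<le> (8/81)^k * (overlap (9/16) ?s + overlap (9/16) (?s - 5/4))"
          by (simp add: distrib_left add_mono)
        also have "\<dots> < gain k"
          unfolding gain_def using overlap_pair_less[of ?s] 6 by (intro mult_strict_left_mono) auto
        finally show ?thesis ..
      qed
    qed
    then show ?case unfolding rec gain_Suc by auto
  qed
  then show "overlap (radius k) t \<le> gain k"
    "overlap (radius k) t = gain k \<Longrightarrow> t \<in> grid k"
    by auto
qed

section \<open>Optimality and uniqueness\<close>

lemma continuous_Min:
  fixes h :: "'b \<Rightarrow> real \<Rightarrow> real"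
  assumes "finite A" "A \<noteq> {}" "\<And>a. a \<in> A \<Longrightarrow> continuous_on UNIV (h a)"
  shows "continuous_on UNIV (\<lambda>x. Min ((\<lambda>a. h a x) ` A))"
  using assms
proof (induction A rule: finite_ne_induct)
  case (insert a A)
  then have "Min ((\<lambda>a. h a x) ` insert a A) = min (h a x) (Min ((\<lambda>a. h a x) ` A))" for x
    by simp
  then show ?case
    using insert by (auto intro!: continuous_on_min simp del: Min_insert image_insert)
qed simp

lemma continuous_sq_dist:
  assumes "finite \<alpha>" "\<alpha> \<noteq> {}"
  shows "continuous_on UNIV (\<lambda>x::real. Min ((\<lambda>a. (x - a)\<^sup>2) ` \<alpha>))"
  by (rule continuous_Min[OF assms]) (intro continuous_intros)

text \<open>The duality bound. It holds for every radius \<open>\<rho>\<close>, and the only loss at \<open>x\<close> comes from points other than a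
nearest one that lie within \<open>\<rho>\<close> of \<open>x\<close>, or from there being no point within \<open>\<rho>\<close>.\<close>

lemma distortion_ge:
  assumes "finite \<alpha>" "\<alpha> \<noteq> {}"
  shows "\<rho>\<^sup>2 - (\<Sum>a\<in>\<alpha>. overlap \<rho> a) \<le> distortion P \<alpha>"
proof -
  have "\<rho>\<^sup>2 - (\<Sum>a\<in>\<alpha>. overlap \<rho> a) = (\<integral>x. \<rho>\<^sup>2 - (\<Sum>a\<in>\<alpha>. max 0 (\<rho>\<^sup>2 - (x - a)\<^sup>2)) \<partial>P)"
  proof -
    have i: "integrable P (\<lambda>x. max 0 (\<rho>\<^sup>2 - (x - a)\<^sup>2))" for a
      by (intro integrable_continuous continuous_intros)
    then have "(\<integral>x. \<rho>\<^sup>2 - (\<Sum>a\<in>\<alpha>. max 0 (\<rho>\<^sup>2 - (x - a)\<^sup>2)) \<partial>P)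
        = \<rho>\<^sup>2 - (\<integral>x. (\<Sum>a\<in>\<alpha>. max 0 (\<rho>\<^sup>2 - (x - a)\<^sup>2)) \<partial>P)"
      by (subst Bochner_Integration.integral_diff) auto
    then show ?thesis
      unfolding overlap_def using i by (simp add: Bochner_Integration.integral_sum)
  qed
  also have "\<dots> \<le> distortion P \<alpha>"
    unfolding distortion_def
  proof (rule integral_mono_unit)
    fix x :: real
    have "Min ((\<lambda>a. (x - a)\<^sup>2) ` \<alpha>) \<in> (\<lambda>a. (x - a)\<^sup>2) ` \<alpha>"
      using assms by (intro Min_in) auto
    then obtain a where a: "a \<in> \<alpha>" "Min ((\<lambda>a. (x - a)\<^sup>2) ` \<alpha>) = (x - a)\<^sup>2" by auto
    have "max 0 (\<rho>\<^sup>2 - (x - a)\<^sup>2) \<le> (\<Sum>a\<in>\<alpha>. max 0 (\<rho>\<^sup>2 - (x - a)\<^sup>2))"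
      using assms a by (intro member_le_sum) auto
    then show "\<rho>\<^sup>2 - (\<Sum>a\<in>\<alpha>. max 0 (\<rho>\<^sup>2 - (x - a)\<^sup>2)) \<le> Min ((\<lambda>a. (x - a)\<^sup>2) ` \<alpha>)"
      unfolding a(2) by simp
  next
    show "continuous_on UNIV (\<lambda>x. Min ((\<lambda>a. (x - a)\<^sup>2) ` \<alpha>))" by (rule continuous_sq_dist[OF assms])
  qed (intro continuous_intros)
  finally show ?thesis .
qed

lemma distortion_lower_bound:
  assumes "finite \<alpha>" "\<alpha> \<noteq> {}"
  shows "(16/81)^k * (5/52) + (2^k - real (card \<alpha>)) * gain k \<le> distortion P \<alpha>"
proof -
  have "(\<Sum>a\<in>\<alpha>. overlap (radius k) a) \<le> real (card \<alpha>) * gain k"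
    by (rule sum_bounded_above) (rule overlap_grid(1))
  then show ?thesis
    using distortion_ge[OF assms, of "radius k"] unfolding radius_squared left_diff_distrib
    by linarith
qed

text \<open>Serving each half of \<open>P\<close> by its own scaled copy of \<open>\<alpha>\<close> is one admissible assignment.\<close>

lemma distortion_scale:
  assumes "finite \<alpha>" "\<alpha> \<noteq> {}"
  shows "distortion P (S1 ` \<alpha> \<union> S2 ` \<alpha>) \<le> 16/81 * distortion P \<alpha>"
proof -
  let ?m = "\<lambda>\<beta> x. Min ((\<lambda>a. (x - a)\<^sup>2) ` \<beta>)" and ?\<beta> = "S1 ` \<alpha> \<union> S2 ` \<alpha>"
  have \<beta>: "finite ?\<beta>" "?\<beta> \<noteq> {}" using assms by auto
  note c = continuous_sq_dist[OF assms] continuous_sq_dist[OF \<beta>]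
  have le: "?m ?\<beta> (S1 x) \<le> 16/81 * ?m \<alpha> x" "?m ?\<beta> (S2 x) \<le> 16/81 * ?m \<alpha> x" for x
  proof -
    have "?m \<alpha> x \<in> (\<lambda>a. (x - a)\<^sup>2) ` \<alpha>"
      using assms by (intro Min_in) auto
    then obtain a where a: "a \<in> \<alpha>" "?m \<alpha> x = (x - a)\<^sup>2" by auto
    have "(S1 x - S1 a)\<^sup>2 = 16/81 * (x - a)\<^sup>2" "(S2 x - S2 a)\<^sup>2 = 16/81 * (x - a)\<^sup>2"
      by (simp_all add: S1_def S2_def power2_eq_square field_simps)
    moreover have "?m ?\<beta> (S1 x) \<le> (S1 x - S1 a)\<^sup>2" "?m ?\<beta> (S2 x) \<le> (S2 x - S2 a)\<^sup>2"
      using \<beta> a(1) by (auto intro!: Min_le)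
    ultimately show "?m ?\<beta> (S1 x) \<le> 16/81 * ?m \<alpha> x" "?m ?\<beta> (S2 x) \<le> 16/81 * ?m \<alpha> x"
      unfolding a(2) by auto
  qed
  have "distortion P ?\<beta> = 1/2 * (\<integral>x. ?m ?\<beta> (S1 x) \<partial>P) + 1/2 * (\<integral>x. ?m ?\<beta> (S2 x) \<partial>P)"
    unfolding distortion_def by (rule integral_self_similar[OF c(2)])
  also have "(\<integral>x. ?m ?\<beta> (S1 x) \<partial>P) \<le> (\<integral>x. 16/81 * ?m \<alpha> x \<partial>P)"
    by (rule integral_mono_unit[OF _ _ le(1)])
      (intro continuous_on_compose2[OF c(2) S_continuous(1)] continuous_on_mult_left c(1) subset_UNIV)+
  also have "(\<integral>x. ?m ?\<beta> (S2 x) \<partial>P) \<le> (\<integral>x. 16/81 * ?m \<alpha> x \<partial>P)"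
    by (rule integral_mono_unit[OF _ _ le(2)])
      (intro continuous_on_compose2[OF c(2) S_continuous(2)] continuous_on_mult_left c(1) subset_UNIV)+
  finally show ?thesis by (simp add: distortion_def)
qed

lemma distortion_grid_le: "distortion P (grid k) \<le> (16/81)^k * (5/52)"
proof (induction k)
  case 0
  show ?case by (simp add: grid_0 distortion_def second_moment)
next
  case (Suc k)
  then show ?case
    using distortion_scale[OF finite_grid grid_nonempty, of k] by (simp add: grid_Suc)
qed

text \<open>If two words had the same midpoint, fewer than \<open>2\<^sup>k\<close> points would reach a distortion that the lower
bound rules out for them.\<close>

lemma card_grid: "card (grid k) = 2^k"
proof (rule antisym[OF card_grid_le])
  have "(2^k - real (card (grid k))) * gain k \<le> 0"
    using distortion_lower_bound[OF finite_grid grid_nonempty, of k k] distortion_grid_le[of k] by linarith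
  then have "2^k - real (card (grid k)) \<le> 0"
    using gain_pos[of k] by (simp add: mult_le_0_iff del: of_nat_power)
  then show "2^k \<le> card (grid k)"
    by simp
qed

lemma distortion_ge_grid:
  assumes "finite \<alpha>" "\<alpha> \<noteq> {}" "card \<alpha> \<le> 2^k"
  shows "(16/81)^k * (5/52) \<le> distortion P \<alpha>"
proof -
  have "real (card \<alpha>) \<le> 2^k"
    using assms(3) by simp
  then have "0 \<le> (2^k - real (card \<alpha>)) * gain k"
    using gain_pos[of k] by (intro mult_nonneg_nonneg) auto
  then show ?thesis using distortion_lower_bound[OF assms(1,2), of k] by linarith
qed

lemma distortion_grid: "distortion P (grid k) = (16/81)^k * (5/52)"
  by (intro antisym distortion_grid_le distortion_ge_grid finite_grid grid_nonempty) (simp add: card_grid)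

text \<open>In the equality case every point must save the full \<open>gain k\<close>, so it is a midpoint, and there must be
\<open>2\<^sup>k\<close> of them.\<close>

lemma distortion_eq_imp_grid:
  assumes "finite \<alpha>" "\<alpha> \<noteq> {}" "card \<alpha> \<le> 2^k" "distortion P \<alpha> \<le> (16/81)^k * (5/52)"
  shows "\<alpha> = grid k"
proof (rule card_subset_eq)
  let ?o = "overlap (radius k)"
  have card: "real (card \<alpha>) \<le> 2^k"
    using assms(3) by simp
  have ge: "2^k * gain k \<le> (\<Sum>a\<in>\<alpha>. ?o a)"
    using distortion_ge[OF assms(1,2), of "radius k"] assms(4) unfolding radius_squared by linarith
  have eq: "?o a = gain k" if "a \<in> \<alpha>" for a
  proof (rule ccontr)
    assume "?o a \<noteq> gain k"
    then have "?o a < gain k" using overlap_grid(1)[of k a] by linarith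
    then have "(\<Sum>a\<in>\<alpha>. ?o a) < (\<Sum>a\<in>\<alpha>. gain k)"
      using assms(1) that overlap_grid(1)[of k] by (intro sum_strict_mono_ex1) auto
    also have "\<dots> \<le> 2^k * gain k"
      using card gain_pos[of k] by (simp add: mult_right_mono)
    finally show False using ge by simp
  qed
  then show sub: "\<alpha> \<subseteq> grid k" using overlap_grid(2) by blast
  have "2^k * gain k \<le> real (card \<alpha>) * gain k" using ge eq by simp
  then have "2^k \<le> real (card \<alpha>)" using gain_pos[of k] by (simp only: mult_le_cancel_right_pos)
  then have "2^k \<le> card \<alpha>"
    by simp
  then show "card \<alpha> = card (grid k)" using assms(3) by (simp add: card_grid)
  show "finite (grid k)" by (rule finite_grid)
qed

end

section \<open>Optimal sets are centroidal\<close>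

lemma voronoi_iff_Min:
  assumes "finite \<alpha>" "a \<in> \<alpha>"
  shows "x \<in> voronoi a \<alpha> \<longleftrightarrow> Min ((\<lambda>b. (x - b)\<^sup>2) ` \<alpha>) = (x - a)\<^sup>2"
proof -
  have ne: "\<alpha> \<noteq> {}" using assms by auto
  have "x \<in> voronoi a \<alpha> \<longleftrightarrow> Min ((\<lambda>b. \<bar>x - b\<bar>) ` \<alpha>) = \<bar>x - a\<bar>"
    by (auto simp: voronoi_def)
  also have "\<dots> \<longleftrightarrow> (\<forall>b\<in>\<alpha>. \<bar>x - a\<bar> \<le> \<bar>x - b\<bar>)"
    using assms ne by (subst Min_eq_iff) auto
  also have "\<dots> \<longleftrightarrow> (\<forall>b\<in>\<alpha>. (x - a)\<^sup>2 \<le> (x - b)\<^sup>2)"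
    by (simp add: abs_le_square_iff)
  also have "\<dots> \<longleftrightarrow> Min ((\<lambda>b. (x - b)\<^sup>2) ` \<alpha>) = (x - a)\<^sup>2"
    using assms ne by (subst Min_eq_iff) auto
  finally show ?thesis .
qed

context cantor_measure begin

lemma voronoi_borel:
  assumes "finite \<alpha>" "a \<in> \<alpha>"
  shows "voronoi a \<alpha> \<in> sets borel"
proof -
  have "voronoi a \<alpha> = {x. Min ((\<lambda>b. (x - b)\<^sup>2) ` \<alpha>) = (x - a)\<^sup>2}"
    using voronoi_iff_Min[OF assms] by auto
  moreover have "closed {x. Min ((\<lambda>b. (x - b)\<^sup>2) ` \<alpha>) = (x - a)\<^sup>2}"
    using assms by (intro closed_Collect_eq continuous_sq_dist continuous_intros) auto
  ultimately show ?thesis by simp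
qed

text \<open>If \<open>a\<close> is moved to \<open>a + e\<close> while every \<open>x\<close> stays assigned to its old region, the cost changes by
\<open>e\<^sup>2 * p - 2 * e * I\<close>, with \<open>p\<close> the mass of the region and \<open>I\<close> its first moment about \<open>a\<close>. The true
change is no larger, so optimality makes this nonnegative for all \<open>e\<close>, which forces \<open>I = 0\<close>.\<close>

lemma optimal_imp_centroid:
  assumes \<alpha>: "finite \<alpha>" "a \<in> \<alpha>"
    and opt: "\<And>c. distortion P \<alpha> \<le> distortion P (insert c (\<alpha> - {a}))"
    and pos: "0 < prob (voronoi a \<alpha>)"
  shows "a = 1 / prob (voronoi a \<alpha>) * (LINT x:voronoi a \<alpha>|P. x)"
proof -
  let ?M = "voronoi a \<alpha>" and ?m = "\<lambda>\<beta> x. Min ((\<lambda>b. (x - b)\<^sup>2) ` \<beta>)"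
  define p where "p = prob ?M"
  define I where "I = (\<integral>x. (x - a) * indicator ?M x \<partial>P)"
  have ne: "\<alpha> \<noteq> {}" using \<alpha> by auto
  have M: "?M \<in> sets P" using voronoi_borel[OF \<alpha>] by simp
  have iI: "integrable P (\<lambda>x. (x - a) * indicator ?M x)"
    by (rule integrable_real_mult_indicator[OF M]) (intro integrable_continuous continuous_intros)
  have ip: "integrable P (\<lambda>x. indicator ?M x :: real)"
    using integrable_real_mult_indicator[OF M, of "\<lambda>_. 1"] by simp
  have im: "integrable P (?m \<beta>)" if "finite \<beta>" "\<beta> \<noteq> {}" for \<beta>
    by (rule integrable_continuous[OF continuous_sq_dist[OF that]])
  have variation: "0 \<le> e\<^sup>2 * p - 2 * e * I" for e
  proof -
    let ?\<beta> = "insert (a + e) (\<alpha> - {a})"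
    have \<beta>: "finite ?\<beta>" "?\<beta> \<noteq> {}" using \<alpha> by auto
    have "?m ?\<beta> x \<le> ?m \<alpha> x + (e\<^sup>2 * indicator ?M x - 2 * e * ((x - a) * indicator ?M x))" for x
    proof (cases "x \<in> ?M")
      case True
      have "?m ?\<beta> x \<le> (x - (a + e))\<^sup>2"
        using \<beta> by (intro Min_le) auto
      also have "\<dots> = (x - a)\<^sup>2 + (e\<^sup>2 - 2 * e * (x - a))"
        by (simp add: power2_eq_square algebra_simps)
      finally show ?thesis
        using True voronoi_iff_Min[OF \<alpha>, of x] by simp
    next
      case False
      have "?m \<alpha> x \<in> (\<lambda>b. (x - b)\<^sup>2) ` \<alpha>"
        using \<alpha> ne by (intro Min_in) auto
      then obtain b where b: "b \<in> \<alpha>" "?m \<alpha> x = (x - b)\<^sup>2" by auto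
      have "b \<noteq> a" using False b voronoi_iff_Min[OF \<alpha>, of x] by auto
      then have "?m ?\<beta> x \<le> (x - b)\<^sup>2"
        using \<beta> b by (intro Min_le) auto
      then show ?thesis using False b by simp
    qed
    then have "distortion P ?\<beta> \<le>
        (\<integral>x. ?m \<alpha> x + (e\<^sup>2 * indicator ?M x - 2 * e * ((x - a) * indicator ?M x)) \<partial>P)"
      unfolding distortion_def using iI ip im[OF \<beta>] im[OF \<alpha>(1) ne]
      by (intro integral_mono Bochner_Integration.integrable_add Bochner_Integration.integrable_diff
          integrable_mult_right) auto
    also have "\<dots> = distortion P \<alpha> + (e\<^sup>2 * p - 2 * e * I)"
    proof -
      have "(\<integral>x. indicator ?M x \<partial>P) = p" using M by (simp add: p_def)
      then show ?thesis
        unfolding distortion_def I_def using iI ip im[OF \<alpha>(1) ne]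
        by (subst Bochner_Integration.integral_add) (auto simp: Bochner_Integration.integral_diff)
    qed
    finally show ?thesis using opt[of "a + e"] by linarith
  qed
  have "0 < p" using pos by (simp add: p_def)
  \<comment> \<open>The displacement \<open>I / p\<close> minimises the quadratic function.\<close>
  have "(I / p)\<^sup>2 * p - 2 * (I / p) * I = - (I\<^sup>2 / p)"
    using \<open>0 < p\<close> by (simp add: power2_eq_square field_simps)
  then have "I\<^sup>2 / p \<le> 0" using variation[of "I / p"] by simp
  then have "I = 0" using \<open>0 < p\<close> by (simp add: divide_le_0_iff)
  have "(LINT x:?M|P. x) = (\<integral>x. (x - a) * indicator ?M x + a * indicator ?M x \<partial>P)"
    unfolding set_lebesgue_integral_def
    by (rule Bochner_Integration.integral_cong) (auto simp: algebra_simps)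
  also have "\<dots> = I + a * p"
    unfolding I_def p_def using iI ip M by (subst Bochner_Integration.integral_add) auto
  finally show ?thesis using \<open>I = 0\<close> \<open>0 < p\<close> by (simp add: p_def)
qed

lemma voronoi_null_imp_redundant:
  assumes \<alpha>: "finite \<alpha>" "a \<in> \<alpha>" "\<alpha> - {a} \<noteq> {}" and null: "prob (voronoi a \<alpha>) = 0"
  shows "distortion P (\<alpha> - {a}) \<le> distortion P \<alpha>"
  unfolding distortion_def
proof (rule integral_mono_AE)
  let ?m = "\<lambda>\<beta> x. Min ((\<lambda>b. (x - b)\<^sup>2) ` \<beta>)"
  have ne: "\<alpha> \<noteq> {}" using \<alpha> by auto
  have M: "voronoi a \<alpha> \<in> sets P" using voronoi_borel[OF \<alpha>(1,2)] by simp
  show "integrable P (?m (\<alpha> - {a}))" "integrable P (?m \<alpha>)"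
    using \<alpha> ne by (auto intro!: integrable_continuous continuous_sq_dist)
  have "AE x in P. x \<notin> voronoi a \<alpha>"
    using null M by (intro AE_not_in) (simp add: null_sets_def emeasure_eq_measure)
  then show "AE x in P. ?m (\<alpha> - {a}) x \<le> ?m \<alpha> x"
  proof eventually_elim
    case (elim x)
    have "?m \<alpha> x \<in> (\<lambda>b. (x - b)\<^sup>2) ` \<alpha>"
      using \<alpha> ne by (intro Min_in) auto
    then obtain b where b: "b \<in> \<alpha>" "?m \<alpha> x = (x - b)\<^sup>2" by auto
    have "b \<noteq> a" using elim b voronoi_iff_Min[OF \<alpha>(1,2), of x] by auto
    then have "?m (\<alpha> - {a}) x \<le> (x - b)\<^sup>2"
      using \<alpha> b by (intro Min_le) auto
    then show ?case using b by simp
  qed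
qed

lemma V_n_grid: "V_n P (2^k) = (16/81)^k * (5/52)"
  unfolding V_n_def
proof (rule cInf_eq_minimum)
  show "(16/81)^k * (5/52) \<in> {distortion P \<alpha> |\<alpha>. finite \<alpha> \<and> \<alpha> \<noteq> {} \<and> card \<alpha> \<le> 2^k}"
    using distortion_grid[of k] finite_grid[of k] grid_nonempty[of k] card_grid[of k]
    by (intro CollectI exI[of _ "grid k"]) simp
qed (use distortion_ge_grid in blast)

text \<open>With \<open>k \<ge> 1\<close> there are at least two midpoints, so that one can be dropped and a competitor remains.\<close>

lemma grid_CVT:
  assumes "1 \<le> k"
  shows "is_CVT P (2^k) (grid k)"
  unfolding is_CVT_def
proof (intro conjI ballI finite_grid card_grid)
  fix a assume a: "a \<in> grid k"
  have two: "(2::nat) \<le> 2^k" using assms self_le_power[of "2::nat" k] by simp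
  have ne: "grid k - {a} \<noteq> {}"
  proof
    assume "grid k - {a} = {}"
    then have "grid k \<subseteq> {a}" by auto
    then have "card (grid k) \<le> 1" using card_mono[of "{a}" "grid k"] by simp
    then show False using two by (simp add: card_grid)
  qed
  show pos: "0 < prob (voronoi a (grid k))"
  proof (rule ccontr)
    assume "\<not> ?thesis"
    then have "prob (voronoi a (grid k)) = 0"
      using measure_nonneg[of P "voronoi a (grid k)"] by linarith
    then have "distortion P (grid k - {a}) \<le> (16/81)^k * (5/52)"
      using voronoi_null_imp_redundant[OF finite_grid a ne] distortion_grid[of k] by simp
    moreover have "card (grid k - {a}) \<le> 2^k"
      using card_Diff1_le[of "grid k" a] by (simp add: card_grid)
    ultimately have "grid k - {a} = grid k"
      using ne finite_grid by (intro distortion_eq_imp_grid) auto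
    then show False using a by auto
  qed
  show "a = 1 / prob (voronoi a (grid k)) * (LINT x:voronoi a (grid k)|P. x)"
  proof (rule optimal_imp_centroid[OF finite_grid a _ pos])
    fix c
    have "card (insert c (grid k - {a})) \<le> Suc (card (grid k - {a}))"
      by (rule card_insert_le_m1) auto
    also have "\<dots> = 2^k"
      using card_Suc_Diff1[OF finite_grid a] by (simp add: card_grid)
    finally show "distortion P (grid k) \<le> distortion P (insert c (grid k - {a}))"
      unfolding distortion_grid using finite_grid by (intro distortion_ge_grid) auto
  qed
qed

end

theorem proposition3p3:
  fixes P :: "real measure" and n k :: nat and \<alpha>\<^sub>n :: "real set"
  assumes "is_cantor_measure P"
    and "k \<ge> 1" and "n = 2 ^ k"
    and "\<alpha>\<^sub>n = {S_word \<sigma> (1/2) | \<sigma>. \<sigma> \<in> words k}"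
  shows "is_optimal_CVT P n \<alpha>\<^sub>n
    \<and> (\<forall>\<beta>. is_optimal_set P n \<beta> \<longrightarrow> \<beta> = \<alpha>\<^sub>n)
    \<and> V_n P n = (4/9) ^ (2 * k) * prob_space.variance P (\<lambda>x. x)"
proof -
  interpret cantor_measure P
    using assms(1) by unfold_locales
  have \<alpha>: "\<alpha>\<^sub>n = grid k"
    using assms(4) by (simp add: grid_def)
  have "is_optimal_set P n \<alpha>\<^sub>n"
    by (simp add: is_optimal_set_def \<alpha> assms(3) finite_grid grid_nonempty card_grid distortion_grid V_n_grid)
  moreover have "is_CVT P n \<alpha>\<^sub>n"
    using grid_CVT[OF assms(2)] by (simp add: \<alpha> assms(3))
  moreover have "\<beta> = \<alpha>\<^sub>n" if "is_optimal_set P n \<beta>" for \<beta>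
    using that distortion_eq_imp_grid[of \<beta> k] by (simp add: is_optimal_set_def \<alpha> assms(3) V_n_grid)
  moreover have "V_n P n = (4/9) ^ (2 * k) * variance (\<lambda>x. x)"
  proof -
    have "(4/9 :: real) ^ (2 * k) = (16/81) ^ k"
      by (simp add: power_mult power2_eq_square)
    then show ?thesis
      by (simp only: assms(3) V_n_grid mean_half second_moment)
  qed
  ultimately show ?thesis
    unfolding is_optimal_CVT_def by blast
qed

end
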